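(* Let $2\le p<\infty$ and $\alpha=\mu+i\nu\in\mathbb{C}\setminus\mathbb{Z}$ with $\mu,\nu\in\mathbb{R}$. Then for all complex-valued $u\in C_c^\infty(\mathbb{R}^2\setminus\{0\})$, $$\int_{\mathbb{R}^2}|\nabla_{A_\infty}u|^p\,dx\ \ge\ \left[\left(\frac{p-2}{p}\right)^p+\left(\frac{|\nu|}{\sinh(\pi|\nu|)}\right)^p\bigl(\sin^2(\pi\mu)+\sinh^2(\pi\nu)\bigr)^{p/2}\right]\int_{\mathbb{R}^2}\frac{|u|^p}{|x|^p}\,dx,$$ where for $\nu=0$ the quotient $|\nu|/\sinh(\pi|\nu|)$ is understood as its limit value $1/\pi$.
   Context: The complex Aharonov--Bohm potential with parameter $\alpha\in\mathbb{C}$ is $A_\infty(x)=(-x_2,x_1)\,\dfrac{\alpha}{|x|^2}$ for $x=(x_1,x_2)\in\mathbb{R}^2\setminus\{0\}$ (a $\mathbb{C}^2$-valued field). The magnetic gradient of a complex-valued function $u$ is $\nabla_{A_\infty}u:=\nabla u-iA_\infty u$, and $|\nabla_{A_\infty}u|$ is its Euclidean (Hermitian) norm in $\mathbb{C}^2$. *)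

theory Defs
  imports "HOL-Analysis.Analysis"
begin

text \<open>\<open>k_times_cont_diff_on k S f\<close>: \<open>f\<close> is of class \<open>C^k\<close> (in the real sense) on the open set \<open>S\<close>,
  i.e. all iterated directional derivatives up to order \<open>k\<close> exist (as Frechet derivatives)
  and are continuous on \<open>S\<close>.\<close>

primrec k_times_cont_diff_on ::
    "nat \<Rightarrow> 'a::real_normed_vector set \<Rightarrow> ('a \<Rightarrow> 'b::real_normed_vector) \<Rightarrow> bool" where
  "k_times_cont_diff_on 0 S f \<longleftrightarrow> continuous_on S f"
| "k_times_cont_diff_on (Suc k) S f \<longleftrightarrow>
     (\<forall>x\<in>S. f differentiable (at x)) \<and>
     (\<forall>v. k_times_cont_diff_on k S (\<lambda>x. frechet_derivative f (at x) v))"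

definition smooth_on ::
    "'a::real_normed_vector set \<Rightarrow> ('a \<Rightarrow> 'b::real_normed_vector) \<Rightarrow> bool" where
  "smooth_on S f \<longleftrightarrow> (\<forall>k. k_times_cont_diff_on k S f)"

text \<open>The elements of \<open>C\<^sub>c\<^sup>\<infinity>(S)\<close>, \<open>S\<close> open, are represented by their extensions by zero to the
  whole space.\<close>

definition test_functions ::
    "'a::real_normed_vector set \<Rightarrow> ('a \<Rightarrow> 'b::real_normed_vector) set" where
  "test_functions S =
     {f. smooth_on S f \<and> compact (closure {x. f x \<noteq> 0}) \<and> closure {x. f x \<noteq> 0} \<subseteq> S}"

definition gradient :: "(real^'n \<Rightarrow> complex) \<Rightarrow> real^'n \<Rightarrow> complex^'n" where
  "gradient u x = (\<chi> j. frechet_derivative u (at x) (axis j 1))"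

text \<open>At \<open>x = 0\<close>, where the potential is not defined, the totalised division gives the value 0.\<close>

definition AB_potential :: "complex \<Rightarrow> real^2 \<Rightarrow> complex^2" where
  "AB_potential \<alpha> x =
     (\<alpha> / complex_of_real ((norm x)\<^sup>2)) *s vector [complex_of_real (- x$2), complex_of_real (x$1)]"

text \<open>The norm on \<^typ>\<open>complex^'n\<close> is the Hermitian norm.\<close>

definition magnetic_gradient ::
    "(real^'n \<Rightarrow> complex^'n) \<Rightarrow> (real^'n \<Rightarrow> complex) \<Rightarrow> real^'n \<Rightarrow> complex^'n" where
  "magnetic_gradient A u x = gradient u x - (\<i> * u x) *s A x"

definition abs_div_sinh_pi :: "real \<Rightarrow> real" where
  "abs_div_sinh_pi \<nu> = (if \<nu> = 0 then 1 / pi else \<bar>\<nu>\<bar> / sinh (pi * \<bar>\<nu>\<bar>))"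

end

theory Submission
  imports Defs
begin

text \<open>Write \<open>x\<^sup>\<bottom> = (-x\<^sub>2, x\<^sub>1)\<close>, \<open>R = x \<cdot> \<nabla>u\<close> and \<open>F = x\<^sup>\<bottom> \<cdot> \<nabla>u - i \<alpha> u\<close>. Then
  \<open>|x|\<^sup>2 |\<nabla>\<^sub>A u|\<^sup>2 = |R|\<^sup>2 + |F|\<^sup>2\<close>, so for \<open>p \<ge> 2\<close> the two parts can be treated separately.
  Instead of polar coordinates we integrate along the flows of dilations and rotations:
  \<open>u(x) = \<integral> R(e\<^sup>-\<^sup>s x) ds\<close> over \<open>s > 0\<close>, and \<open>(1 - e\<^sup>2\<^sup>\<pi>\<^sup>i\<^sup>\<alpha>) u(x) = \<integral> e\<^sup>i\<^sup>\<alpha>\<^sup>s F(\<rho>\<^sub>s x) ds\<close> over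
  \<open>0 < s < 2\<pi>\<close>, with \<open>\<rho>\<^sub>s\<close> the rotation by \<open>-s\<close>. Since these flows scale the norm of
  \<open>L\<^sup>p(|x|\<^sup>-\<^sup>p dx)\<close> by an explicit factor, Minkowski's integral inequality bounds \<open>u\<close> by \<open>R\<close> and by \<open>F\<close>
  with exactly the two constants of the theorem.\<close>

section \<open>Convexity inequalities for real powers\<close>

text \<open>Split \<open>z powr q\<close> as \<open>z * z powr (q - 1)\<close> and bound both second
  factors by \<open>(x + y) powr (q - 1)\<close>. Applied with \<open>q = p / 2\<close>, this is
  where the assumption \<open>2 \<le> p\<close> lets the radial and angular parts be
  separated.\<close>

lemma powr_add_superadditive:
  fixes x y q :: real
  assumes "0 \<le> x" "0 \<le> y" "1 \<le> q"
  shows "x powr q + y powr q \<le> (x + y) powr q"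
proof -
  have split: "z powr q = z * z powr (q - 1)" if "0 \<le> z" for z :: real
    using that powr_add[of z 1 "q - 1"] by (cases "z = 0") auto
  have "x * x powr (q - 1) \<le> x * (x + y) powr (q - 1)"
    "y * y powr (q - 1) \<le> y * (x + y) powr (q - 1)"
    using assms by (auto intro!: mult_left_mono powr_mono2)
  then show ?thesis
    using assms by (simp add: split distrib_right)
qed

text \<open>By convexity the tangent to \<open>y powr p\<close> at \<open>t\<close> lies below the
  graph. The proof is Young's inequality for \<open>y\<close> and \<open>t powr (p - 1)\<close>,
  with \<open>q\<close> the exponent conjugate to \<open>p\<close>.\<close>

lemma powr_tangent_line:
  fixes y t p :: real
  assumes "0 \<le> y" "0 \<le> t" "1 < p"
  shows "p * t powr (p - 1) * y - (p - 1) * t powr p \<le> y powr p"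
proof -
  define q where "q = p / (p - 1)"
  have "y * t powr (p - 1) \<le> y powr p / p + (t powr (p - 1)) powr q / q"
    using assms by (intro Youngs_inequality) (auto simp: q_def field_simps)
  also have "(t powr (p - 1)) powr q = t powr p"
    using assms by (simp add: powr_powr q_def)
  finally have "p * (y * t powr (p - 1)) \<le> p * (y powr p / p + t powr p / q)"
    using assms by (intro mult_left_mono) auto
  also have "\<dots> = y powr p + (p - 1) * t powr p"
    using assms by (simp add: q_def field_simps)
  finally show ?thesis
    by (simp add: mult_ac)
qed

text \<open>Take the tangent at the weighted mean \<open>t\<close> of \<open>y\<close> and integrate
  it against \<open>w\<close>: the result is \<open>t powr p * W\<close> on the smaller side.
  Multiplying by \<open>W powr (p - 1)\<close> turns this into \<open>(t * W) powr p\<close>, so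
  \<open>w\<close> need not have total mass 1.\<close>

lemma Jensen_powr_integral:
  fixes w y :: "real \<Rightarrow> real"
  assumes p: "1 < p" and w: "continuous_on {0..T} w" and y: "continuous_on {0..T} y"
    and w0: "\<And>s. s \<in> {0..T} \<Longrightarrow> 0 \<le> w s" and y0: "\<And>s. s \<in> {0..T} \<Longrightarrow> 0 \<le> y s"
    and W: "0 < integral {0..T} w"
  shows "integral {0..T} (\<lambda>s. w s * y s) powr p
    \<le> integral {0..T} w powr (p - 1) * integral {0..T} (\<lambda>s. w s * y s powr p)"
proof -
  define W where "W = integral {0..T} w"
  define I where "I = integral {0..T} (\<lambda>s. w s * y s)"
  define t where "t = I / W"
  have int1: "w integrable_on {0..T}"
    and int2: "(\<lambda>s. w s * y s) integrable_on {0..T}"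
    and int3: "(\<lambda>s. w s * y s powr p) integrable_on {0..T}"
    using p y0 by (auto intro!: integrable_continuous_interval continuous_intros w y continuous_on_powr')
  have "0 \<le> I"
    unfolding I_def by (intro integral_nonneg int2 mult_nonneg_nonneg w0 y0)
  with W have t0: "0 \<le> t"
    by (simp add: t_def W_def)
  have "integral {0..T} (\<lambda>s. p * t powr (p - 1) * (w s * y s) - (p - 1) * t powr p * w s)
      \<le> integral {0..T} (\<lambda>s. w s * y s powr p)"
  proof (intro integral_le int3 integrable_diff integrable_on_mult_right int1 int2)
    fix s assume s: "s \<in> {0..T}"
    have "w s * (p * t powr (p - 1) * y s - (p - 1) * t powr p) \<le> w s * y s powr p"
      using s by (intro mult_left_mono powr_tangent_line y0 t0 p w0)
    then show "p * t powr (p - 1) * (w s * y s) - (p - 1) * t powr p * w s \<le> w s * y s powr p"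
      by (simp add: algebra_simps)
  qed
  also have "integral {0..T} (\<lambda>s. p * t powr (p - 1) * (w s * y s) - (p - 1) * t powr p * w s)
      = p * t powr (p - 1) * I - (p - 1) * t powr p * W"
    by (subst integral_diff)
      (auto intro!: integrable_on_mult_right int1 int2 simp: I_def W_def integral_mult_right)
  also have "I = t * W"
    using W by (simp add: t_def W_def)
  also have "p * t powr (p - 1) * (t * W) - (p - 1) * t powr p * W = t powr p * W"
    using powr_add[of t "p - 1" 1] t0 by (cases "t = 0") (auto simp: algebra_simps)
  finally have "t powr p * W \<le> integral {0..T} (\<lambda>s. w s * y s powr p)" .
  then have "W powr (p - 1) * (t powr p * W)
      \<le> W powr (p - 1) * integral {0..T} (\<lambda>s. w s * y s powr p)"
    by (intro mult_left_mono) auto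
  also have "W powr (p - 1) * (t powr p * W) = (t * W) powr p"
    using powr_add[of W "p - 1" 1] t0 W by (simp add: powr_mult W_def)
  also have "t * W = I"
    using W by (simp add: t_def W_def)
  finally show ?thesis
    by (simp add: I_def W_def)
qed

section \<open>Minkowski's integral inequality\<close>

lemma nn_integral_compact_interval_continuous:
  fixes h :: "real \<Rightarrow> real"
  assumes "continuous_on {a..b} h" "\<And>s. s \<in> {a..b} \<Longrightarrow> 0 \<le> h s"
  shows "(\<integral>\<^sup>+s. ennreal (h s) * indicator {a..b} s \<partial>lborel) = ennreal (integral {a..b} h)"
  using assms
  by (intro nn_integral_has_integral_lebesgue' integrable_integral integrable_continuous_interval)

text \<open>Minkowski's integral inequality; taking \<open>k m\<close> as weight reduces it to Jensen's inequality.\<close>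

lemma Lp_bound_integral_translates:
  fixes v g :: "'a::euclidean_space \<Rightarrow> real" and L :: "real \<Rightarrow> 'a \<Rightarrow> 'a"
  assumes p: "1 < p" and T: "0 < T"
    and k: "continuous_on UNIV k" "\<And>s. 0 < k s"
    and m: "continuous_on UNIV m" "\<And>s. 0 < m s"
    and L: "continuous_on UNIV (\<lambda>z. L (fst z) (snd z))"
    and g: "continuous_on UNIV g" "\<And>x. 0 \<le> g x"
    and v0: "\<And>x. 0 \<le> v x"
    and v: "\<And>x. v x \<le> integral {0..T} (\<lambda>s. k s * g (L s x))"
    and scale: "\<And>s. (\<integral>\<^sup>+x. ennreal (g (L s x) powr p) \<partial>lborel)
      = ennreal (m s powr p) * (\<integral>\<^sup>+x. ennreal (g x powr p) \<partial>lborel)"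
  shows "(\<integral>\<^sup>+x. ennreal (v x powr p) \<partial>lborel)
    \<le> ennreal (integral {0..T} (\<lambda>s. k s * m s) powr p) * (\<integral>\<^sup>+x. ennreal (g x powr p) \<partial>lborel)"
proof -
  define w where "w s = k s * m s" for s
  define W where "W = integral {0..T} w"
  \<comment> \<open>This is \<open>w s / m s powr p\<close>: the factor left when \<open>m s\<close>
    is pulled out of the power in \<open>w s * (g (L s x) / m s) powr p\<close>.\<close>
  define c where "c s = k s * m s powr (1 - p)" for s
  define N where "N = (\<integral>\<^sup>+x. ennreal (g x powr p) \<partial>lborel)"
  have w: "continuous_on A w" "0 < w s" for A s
    using continuous_on_subset[OF k(1)] continuous_on_subset[OF m(1)] k(2) m(2)
    by (auto simp: w_def[abs_def] intro!: continuous_intros)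
  have c: "continuous_on A c" "0 < c s" for A s
    using continuous_on_subset[OF k(1)] continuous_on_subset[OF m(1)] k(2) m(2)
    by (auto simp: c_def[abs_def] less_imp_neq[OF m(2), symmetric] intro!: continuous_intros)
  have W: "0 < W"
  proof -
    have "W \<noteq> 0"
      using integral_eq_0_iff[OF w(1), of 0 T] w(2) T unfolding W_def
      by (metis atLeastAtMost_iff less_eq_real_def order_less_irrefl)
    moreover have "0 \<le> W"
      unfolding W_def using w(2) by (intro integral_nonneg integrable_continuous_interval w(1)) (auto simp: less_imp_le)
    ultimately show ?thesis by simp
  qed
  have gL2: "continuous_on UNIV (\<lambda>z. g (L (fst z) (snd z)))"
    by (intro continuous_on_compose2[OF g(1) L]) auto
  have gL: "continuous_on A (\<lambda>s. g (L s x))" for A x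
    using continuous_on_compose2[OF gL2, of A "\<lambda>s. (s, x)"]
    by (simp add: continuous_on_Pair)
  have cw: "c s * g (L s x) powr p = w s * (g (L s x) / m s) powr p" for s x
    using m(2)[of s] g(2)[of "L s x"]
    by (simp add: c_def w_def powr_divide powr_diff)
  have pointwise: "ennreal (v x powr p) \<le> ennreal (W powr (p - 1)) *
      (\<integral>\<^sup>+s. ennreal (c s * g (L s x) powr p) * indicator {0..T} s \<partial>lborel)" for x
  proof -
    \<comment> \<open>Dividing \<open>g (L s x)\<close> by \<open>m s\<close> makes its p-norm
      independent of \<open>s\<close>, so Jensen's inequality with weight \<open>w\<close> loses
      nothing beyond the total mass \<open>W\<close>.\<close>
    have "v x \<le> integral {0..T} (\<lambda>s. w s * (g (L s x) / m s))"
      using v[of x] less_imp_neq[OF m(2), symmetric] by (simp add: w_def)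
    then have "v x powr p \<le> integral {0..T} (\<lambda>s. w s * (g (L s x) / m s)) powr p"
      using p v0 by (intro powr_mono2) auto
    also have "\<dots> \<le> W powr (p - 1) * integral {0..T} (\<lambda>s. w s * (g (L s x) / m s) powr p)"
      unfolding W_def using p W w m g(2)
      by (intro Jensen_powr_integral)
        (auto simp: W_def less_imp_le less_imp_neq[OF m(2), symmetric]
          intro!: continuous_intros gL continuous_on_subset[OF m(1)])
    also have "\<dots> = W powr (p - 1) * integral {0..T} (\<lambda>s. c s * g (L s x) powr p)"
      by (simp add: cw)
    finally have "ennreal (v x powr p)
        \<le> ennreal (W powr (p - 1)) * ennreal (integral {0..T} (\<lambda>s. c s * g (L s x) powr p))"
      by (simp add: ennreal_leI flip: ennreal_mult')
    also have "ennreal (integral {0..T} (\<lambda>s. c s * g (L s x) powr p))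
        = (\<integral>\<^sup>+s. ennreal (c s * g (L s x) powr p) * indicator {0..T} s \<partial>lborel)"
      using p c(2) g(2)
      by (intro nn_integral_compact_interval_continuous[symmetric])
        (auto intro!: continuous_intros c gL continuous_on_powr' simp: less_imp_le)
    finally show ?thesis .
  qed
  have meas: "(\<lambda>z. ennreal (c (fst z) * g (L (fst z) (snd z)) powr p) * indicator {0..T} (fst z))
      \<in> borel_measurable (lborel \<Otimes>\<^sub>M lborel)"
  proof -
    have [measurable]: "(\<lambda>z. g (L (fst z) (snd z))) \<in> borel_measurable (lborel \<Otimes>\<^sub>M lborel)"
      using borel_measurable_continuous_onI[OF gL2] by (simp add: lborel_prod)
    have [measurable]: "c \<in> borel_measurable borel"
      by (intro borel_measurable_continuous_onI c)
    show ?thesis by measurable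
  qed
  have [measurable]: "(\<lambda>x. \<integral>\<^sup>+s. ennreal (c s * g (L s x) powr p) * indicator {0..T} s \<partial>lborel)
      \<in> borel_measurable lborel"
    by (intro lborel.borel_measurable_nn_integral)
      (use measurable_pair_swap[OF meas] in \<open>simp add: case_prod_beta'\<close>)
  have gLm: "(\<lambda>x. ennreal (g (L s x) powr p)) \<in> borel_measurable lborel" for s
  proof -
    have "continuous_on UNIV (\<lambda>x. g (L s x))"
      using continuous_on_compose2[OF gL2 continuous_on_Pair[OF continuous_on_const continuous_on_id]]
      by simp
    then have [measurable]: "(\<lambda>x. g (L s x)) \<in> borel_measurable borel"
      by (rule borel_measurable_continuous_onI)
    show ?thesis by measurable
  qed
  have "(\<integral>\<^sup>+x. ennreal (v x powr p) \<partial>lborel) \<le> (\<integral>\<^sup>+x. ennreal (W powr (p - 1)) *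
      (\<integral>\<^sup>+s. ennreal (c s * g (L s x) powr p) * indicator {0..T} s \<partial>lborel) \<partial>lborel)"
    by (intro nn_integral_mono pointwise)
  also have "\<dots> = ennreal (W powr (p - 1)) *
      (\<integral>\<^sup>+x. (\<integral>\<^sup>+s. ennreal (c s * g (L s x) powr p) * indicator {0..T} s \<partial>lborel) \<partial>lborel)"
    by (intro nn_integral_cmult) measurable
  \<comment> \<open>Tonelli's theorem; after the exchange the inner integral over \<open>x\<close>
    is known from \<open>scale\<close>.\<close>
  also have "(\<integral>\<^sup>+x. (\<integral>\<^sup>+s. ennreal (c s * g (L s x) powr p) * indicator {0..T} s \<partial>lborel) \<partial>lborel)
      = (\<integral>\<^sup>+s. (\<integral>\<^sup>+x. ennreal (c s * g (L s x) powr p) * indicator {0..T} s \<partial>lborel) \<partial>lborel)"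
    by (intro lborel_pair.Fubini') (use meas in \<open>simp add: case_prod_beta'\<close>)
  also have "\<dots> = (\<integral>\<^sup>+s. ennreal (w s) * indicator {0..T} s * N \<partial>lborel)"
  proof (intro nn_integral_cong)
    fix s :: real
    have "(\<integral>\<^sup>+x. ennreal (c s * g (L s x) powr p) * indicator {0..T} s \<partial>lborel)
        = (\<integral>\<^sup>+x. (ennreal (c s) * indicator {0..T} s) * ennreal (g (L s x) powr p) \<partial>lborel)"
      using c(2)[of s] by (intro nn_integral_cong) (simp add: ennreal_mult less_imp_le mult_ac)
    also have "\<dots> = (ennreal (c s) * indicator {0..T} s) * (ennreal (m s powr p) * N)"
      by (subst nn_integral_cmult[OF gLm]) (simp add: scale N_def)
    also have "\<dots> = ennreal (c s * m s powr p) * indicator {0..T} s * N"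
      using c(2)[of s] by (simp add: ennreal_mult less_imp_le mult_ac)
    also have "c s * m s powr p = w s"
      using m(2)[of s] powr_add[of "m s" "1 - p" p] by (simp add: c_def w_def)
    finally show "(\<integral>\<^sup>+x. ennreal (c s * g (L s x) powr p) * indicator {0..T} s \<partial>lborel)
        = ennreal (w s) * indicator {0..T} s * N" .
  qed
  also have "\<dots> = (\<integral>\<^sup>+s. ennreal (w s) * indicator {0..T} s \<partial>lborel) * N"
  proof (intro nn_integral_multc)
    have [measurable]: "w \<in> borel_measurable borel"
      by (intro borel_measurable_continuous_onI w)
    show "(\<lambda>s. ennreal (w s) * indicator {0..T} s) \<in> borel_measurable lborel"
      by measurable
  qed
  also have "(\<integral>\<^sup>+s. ennreal (w s) * indicator {0..T} s \<partial>lborel) = ennreal W"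
    unfolding W_def using w by (intro nn_integral_compact_interval_continuous) (auto simp: less_imp_le)
  also have "ennreal (W powr (p - 1)) * (ennreal W * N) = ennreal (W powr p) * N"
    using W powr_add[of W "p - 1" 1]
    by (simp add: mult.assoc[symmetric] less_imp_le flip: ennreal_mult)
  finally show ?thesis
    by (simp add: W_def w_def[abs_def] N_def)
qed

section \<open>Changes of variables, integrability and division by the norm\<close>

text \<open>The image of Lebesgue measure under \<open>f\<close> gives every box its usual volume,
  because \<open>inv f\<close> is orthogonal too and preserves measure. Boxes determine
  \<open>lborel\<close>, so the image measure is \<open>lborel\<close> itself.\<close>

lemma nn_integral_lborel_orthogonal:
  fixes f :: "real^'n::{finite,wellorder} \<Rightarrow> real^'n::_" and h :: "real^'n::_ \<Rightarrow> ennreal"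
  assumes f: "orthogonal_transformation f" and h: "h \<in> borel_measurable borel"
  shows "(\<integral>\<^sup>+x. h (f x) \<partial>lborel) = (\<integral>\<^sup>+x. h x \<partial>lborel)"
proof -
  have fm [measurable]: "f \<in> borel_measurable borel"
    using f by (intro borel_measurable_continuous_onI linear_continuous_on)
      (simp add: orthogonal_transformation_linear linear_conv_bounded_linear[symmetric])
  have f': "orthogonal_transformation (inv f)"
    using f by (rule orthogonal_transformation_inv)
  have "lborel = distr lborel borel f"
  proof (rule lborel_eqI)
    fix l u :: "real^'n::{finite,wellorder}" assume lu: "\<And>b. b \<in> Basis \<Longrightarrow> l \<bullet> b \<le> u \<bullet> b"
    have vimage: "f -` box l u = inv f ` box l u"
      using orthogonal_transformation_bij[OF f] by (rule bij_vimage_eq_inv_image)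
    have lm: "inv f ` box l u \<in> lmeasurable"
      by (intro measurable_orthogonal_image f') auto
    have borel: "f -` box l u \<in> sets borel"
      using measurable_sets[OF fm, of "box l u"] by simp
    have "emeasure (distr lborel borel f) (box l u) = emeasure lebesgue (f -` box l u)"
      using borel by (subst emeasure_distr) auto
    also have "\<dots> = ennreal (measure lebesgue (inv f ` box l u))"
      unfolding vimage by (intro emeasure_eq_ennreal_measure fmeasurableD2 lm)
    also have "\<dots> = ennreal (measure lebesgue (box l u))"
      by (subst measure_orthogonal_image[OF f']) auto
    also have "\<dots> = ennreal (\<Prod>b\<in>Basis. (u - l) \<bullet> b)"
      using lu by (simp add: measure_lborel_box_eq)
    finally show "emeasure (distr lborel borel f) (box l u) = ennreal (\<Prod>b\<in>Basis. (u - l) \<bullet> b)" .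
  qed simp
  then have "(\<integral>\<^sup>+x. h x \<partial>lborel) = (\<integral>\<^sup>+x. h x \<partial>distr lborel borel f)"
    by simp
  also have "\<dots> = (\<integral>\<^sup>+x. h (f x) \<partial>lborel)"
    using h by (subst nn_integral_distr) auto
  finally show ?thesis ..
qed

lemma nn_integral_lborel_dilation:
  fixes h :: "'a::euclidean_space \<Rightarrow> ennreal"
  assumes c: "0 < c" and h [measurable]: "h \<in> borel_measurable borel"
  shows "(\<integral>\<^sup>+x. h (c *\<^sub>R x) \<partial>lborel) = ennreal (c powr - real DIM('a)) * (\<integral>\<^sup>+x. h x \<partial>lborel)"
proof -
  have "(\<integral>\<^sup>+x. h x \<partial>lborel)
      = (\<integral>\<^sup>+x. h x \<partial>density (distr lborel borel (\<lambda>x. 0 + c *\<^sub>R x)) (\<lambda>_. ennreal (\<bar>c\<bar> ^ DIM('a))))"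
    using c by (subst lborel_affine[of c 0]) (simp_all add: ennreal_power)
  also have "\<dots> = ennreal (c ^ DIM('a)) * (\<integral>\<^sup>+x. h (c *\<^sub>R x) \<partial>lborel)"
    using c by (simp add: nn_integral_density nn_integral_distr nn_integral_cmult)
  also have "ennreal (c powr - real DIM('a)) * \<dots> = (\<integral>\<^sup>+x. h (c *\<^sub>R x) \<partial>lborel)"
    using c by (simp add: mult.assoc[symmetric] powr_minus powr_realpow flip: ennreal_mult)
  finally show ?thesis ..
qed

lemma integrable_lborel_continuous_bounded_support:
  fixes h :: "'a::euclidean_space \<Rightarrow> real"
  assumes "continuous_on UNIV h" and "\<And>x. b < norm x \<Longrightarrow> h x = 0"
  shows "integrable lborel h"
proof -
  have "integrable lborel (\<lambda>x. indicator (cball 0 b) x *\<^sub>R h x)"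
    by (intro borel_integrable_compact compact_cball continuous_on_subset[OF assms(1)]) auto
  moreover have "(\<lambda>x. indicator (cball 0 b) x *\<^sub>R h x) = h"
    using assms(2) by (auto simp: fun_eq_iff indicator_def not_le)
  ultimately show ?thesis by simp
qed

text \<open>Away from the origin this is an ordinary quotient; on the ball of radius
  \<open>a\<close> it is identically 0, including at the origin, where
  \<open>0 / 0 = 0\<close>.\<close>

lemma continuous_on_divide_norm:
  fixes f :: "'a::real_normed_vector \<Rightarrow> real"
  assumes f: "continuous_on UNIV f" and "0 < a" and f0: "\<And>x. norm x < a \<Longrightarrow> f x = 0"
  shows "continuous_on UNIV (\<lambda>x. f x / norm x)"
proof -
  have "continuous_on (- {0}) (\<lambda>x. f x / norm x)"
    by (auto intro!: continuous_intros continuous_on_subset[OF f])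
  moreover have "continuous_on (ball 0 a) (\<lambda>x. f x / norm x)"
    by (rule continuous_on_eq[of _ "\<lambda>_. 0"]) (auto simp: f0)
  ultimately have "continuous_on (- {0} \<union> ball 0 a) (\<lambda>x. f x / norm x)"
    by (intro continuous_on_open_Un) auto
  moreover have "- {0} \<union> ball (0::'a) a = UNIV"
    using \<open>0 < a\<close> by auto
  ultimately show ?thesis by simp
qed

section \<open>Rotations of the plane\<close>

definition perp :: "real^2 \<Rightarrow> real^2" where
  "perp x = vector [- x$2, x$1]"

lemma perp_nth [simp]: "perp x $ 1 = - x $ 2" "perp x $ 2 = x $ 1"
  by (simp_all add: perp_def)

lemma perp_axis: "perp x = (- x $ 2) *\<^sub>R axis 1 1 + x $ 1 *\<^sub>R axis 2 1"
  by (simp add: vec_eq_iff forall_2 axis_def)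

lemma norm_vec2_sq: "(norm x)\<^sup>2 = (norm (x $ 1))\<^sup>2 + (norm (x $ 2))\<^sup>2"
  for x :: "'a::real_normed_vector^2"
  by (simp add: norm_vec_def L2_set_def sum_2 real_sqrt_pow2)

text \<open>The clockwise rotation by \<open>s\<close>. With this orientation \<open>s\<close> runs
  along the flow of \<open>- perp\<close>, just as \<open>exp (- s) *\<^sub>R x\<close> runs along
  the flow of minus the identity, so the radial and angular arguments have the same signs.\<close>

definition rot :: "real \<Rightarrow> real^2 \<Rightarrow> real^2" where
  "rot s x = cos s *\<^sub>R x - sin s *\<^sub>R perp x"

lemma rot_nth [simp]:
  "rot s x $ 1 = cos s * x $ 1 + sin s * x $ 2" "rot s x $ 2 = cos s * x $ 2 - sin s * x $ 1"
  by (simp_all add: rot_def)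

lemma norm_rot [simp]: "norm (rot s x) = norm x"
proof -
  have "(norm (rot s x))\<^sup>2 = ((cos s)\<^sup>2 + (sin s)\<^sup>2) * ((x $ 1)\<^sup>2 + (x $ 2)\<^sup>2)"
    unfolding norm_vec2_sq rot_nth real_norm_def power2_abs by algebra
  then have "(norm (rot s x))\<^sup>2 = (norm x)\<^sup>2"
    by (simp add: norm_vec2_sq[of x])
  then show ?thesis
    by (simp add: power2_eq_iff_nonneg)
qed

lemma orthogonal_transformation_rot: "orthogonal_transformation (rot s)"
  unfolding orthogonal_transformation
  by (auto intro!: linearI simp: vec_eq_iff forall_2 algebra_simps)

lemma has_vector_derivative_rot:
  "((\<lambda>s. rot s x) has_vector_derivative - perp (rot s x)) (at s within A)"
proof -
  have "- perp (rot s x) = (- sin s) *\<^sub>R x - cos s *\<^sub>R perp x"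
    by (auto simp: vec_eq_iff forall_2)
  then show ?thesis
    unfolding rot_def
    by (auto intro!: derivative_eq_intros has_vector_derivative_scaleR
        simp: has_vector_derivative_def scaleR_diff_right mult.commute)
qed

lemma continuous_on_perp [continuous_intros]:
  "continuous_on A f \<Longrightarrow> continuous_on A (\<lambda>x. perp (f x))"
  unfolding perp_axis by (intro continuous_intros)

lemma continuous_on_rot: "continuous_on UNIV (\<lambda>z. rot (fst z) (snd z))"
  unfolding rot_def by (intro continuous_intros)

section \<open>Radial and angular parts of the magnetic gradient\<close>

text \<open>The properties of a test function on the punctured plane that enter the estimates.
  Vanishing near the origin makes \<open>u\<close> of class C^1 on the whole plane, so no integral
  has to avoid the singularity.\<close>

locale C1_annulus_support =
  fixes u :: "real^2 \<Rightarrow> complex" and a b :: real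
  assumes a: "0 < a" and ab: "a < b"
    and differentiable: "\<And>x. u differentiable (at x)"
    and continuous_derivative: "\<And>v. continuous_on UNIV (\<lambda>x. frechet_derivative u (at x) v)"
    and u_zero: "\<And>x. norm x < a \<or> b < norm x \<Longrightarrow> u x = 0"
begin

abbreviation D where "D x \<equiv> frechet_derivative u (at x)"

lemma has_derivative: "(u has_derivative D x) (at x)"
  using differentiable frechet_derivative_works by blast

lemma linear_D: "linear (D x)"
  using has_derivative by (rule has_derivative_linear)

lemma D_zero:
  assumes "norm x < a \<or> b < norm x"
  shows "D x v = 0"
proof -
  have "open {x. norm x < a \<or> b < norm x}"
    by (intro open_Collect_disj open_Collect_less continuous_intros)
  then have "((\<lambda>_. 0) has_derivative D x) (at x)"
    using has_derivative_transform_within_open[OF has_derivative, of "{x. norm x < a \<or> b < norm x}" x "\<lambda>_. 0"]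
      assms u_zero by auto
  then have "D x = (\<lambda>_. 0)"
    by (rule has_derivative_unique) (rule has_derivative_const)
  then show ?thesis by simp
qed

lemma D_components: "D x v = v $ 1 *\<^sub>R D x (axis 1 1) + v $ 2 *\<^sub>R D x (axis 2 1)"
proof -
  have "v = v $ 1 *\<^sub>R axis 1 1 + v $ 2 *\<^sub>R axis 2 1"
    by (simp add: vec_eq_iff forall_2 axis_def)
  then have "D x v = D x (v $ 1 *\<^sub>R axis 1 1 + v $ 2 *\<^sub>R axis 2 1)"
    by simp
  also have "\<dots> = v $ 1 *\<^sub>R D x (axis 1 1) + v $ 2 *\<^sub>R D x (axis 2 1)"
    by (simp add: linear_add[OF linear_D] linear_scale[OF linear_D])
  finally show ?thesis .
qed

lemma continuous_on_u: "continuous_on UNIV u"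
  by (intro continuous_at_imp_continuous_on ballI differentiable_imp_continuous_within differentiable)

lemma continuous_on_D:
  assumes "continuous_on UNIV w"
  shows "continuous_on UNIV (\<lambda>x. D x (w x))"
  by (subst D_components) (intro continuous_intros assms continuous_derivative)

text \<open>In polar coordinates \<open>radial\<close> is r times the r-derivative of
  \<open>u\<close>, and \<open>angular\<close> below is the covariant derivative in the polar angle.
  Without a division by \<open>norm x\<close> both are continuous everywhere.\<close>

definition radial :: "real^2 \<Rightarrow> complex" where
  "radial x = D x x"

definition angular :: "complex \<Rightarrow> real^2 \<Rightarrow> complex" where
  "angular \<alpha> x = D x (perp x) - \<i> * \<alpha> * u x"

lemma continuous_on_radial: "continuous_on UNIV radial"
  unfolding radial_def[abs_def] by (intro continuous_on_D continuous_intros)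

lemma continuous_on_angular: "continuous_on UNIV (angular \<alpha>)"
  unfolding angular_def[abs_def] by (intro continuous_on_D continuous_intros continuous_on_u)

lemma radial_zero: "norm x < a \<or> b < norm x \<Longrightarrow> radial x = 0"
  by (simp add: radial_def D_zero)

lemma angular_zero: "norm x < a \<or> b < norm x \<Longrightarrow> angular \<alpha> x = 0"
  by (simp add: angular_def D_zero u_zero)

lemma continuous_on_norm_divide:
  fixes f :: "real^2 \<Rightarrow> complex"
  assumes "continuous_on UNIV f" "\<And>x. norm x < a \<or> b < norm x \<Longrightarrow> f x = 0"
  shows "continuous_on UNIV (\<lambda>x. norm (f x) / norm x)"
  using assms a by (intro continuous_on_divide_norm[of _ a] continuous_intros) auto

lemma integrable_norm_divide_powr:
  fixes f :: "real^2 \<Rightarrow> complex"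
  assumes "continuous_on UNIV f" "\<And>x. norm x < a \<or> b < norm x \<Longrightarrow> f x = 0" "0 < p"
  shows "integrable lborel (\<lambda>x. (norm (f x) / norm x) powr p)"
  using assms
  by (intro integrable_lborel_continuous_bounded_support[of _ b] continuous_on_powr'
      continuous_on_norm_divide continuous_intros) auto

text \<open>The potential is \<alpha> times \<open>perp x\<close> divided by
  \<open>(norm x)\<^sup>2\<close>. It has no component along \<open>x\<close>, and its product with
  \<open>perp x\<close> is \<alpha>. Hence \<open>radial x\<close> and
  \<open>angular \<alpha> x\<close> are \<open>norm x\<close> times the components of the magnetic
  gradient in the orthonormal frame given by the directions of \<open>x\<close> and
  \<open>perp x\<close>.\<close>

lemma norm_magnetic_gradient:
  "norm (magnetic_gradient (AB_potential \<alpha>) u x)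
    = sqrt ((norm (radial x) / norm x)\<^sup>2 + (norm (angular \<alpha> x) / norm x)\<^sup>2)"
proof (cases "x = 0")
  \<comment> \<open>At the origin \<open>u\<close> and its derivative vanish, and division by 0
    gives 0, so both sides are 0.\<close>
  case True
  then show ?thesis
    using a by (simp add: magnetic_gradient_def gradient_def D_zero u_zero flip: zero_vec_def)
next
  case False
  define g where "g = magnetic_gradient (AB_potential \<alpha>) u x"
  define n where "n = (norm x)\<^sup>2"
  have n: "n = (x $ 1)\<^sup>2 + (x $ 2)\<^sup>2"
    by (simp add: n_def norm_vec2_sq)
  have n0: "n \<noteq> 0"
    using False by (simp add: n_def)
  have g1: "g $ 1 = D x (axis 1 1) + \<i> * u x * \<alpha> * of_real (x $ 2) / of_real n"
    and g2: "g $ 2 = D x (axis 2 1) - \<i> * u x * \<alpha> * of_real (x $ 1) / of_real n"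
    by (simp_all add: g_def magnetic_gradient_def gradient_def AB_potential_def n_def)
  have rad: "radial x = of_real (x $ 1) * g $ 1 + of_real (x $ 2) * g $ 2"
    unfolding radial_def D_components[of x x] g1 g2 by (simp add: scaleR_conv_of_real algebra_simps)
  have n': "of_real n = of_real (x $ 1) * of_real (x $ 1) + of_real (x $ 2) * (of_real (x $ 2) :: complex)"
    by (simp add: n power2_eq_square)
  have "angular \<alpha> x = of_real (x $ 1) * g $ 2 - of_real (x $ 2) * g $ 1
      + (of_real (x $ 1) * of_real (x $ 1) + of_real (x $ 2) * of_real (x $ 2)) * (\<i> * u x * \<alpha>) / of_real n - \<i> * \<alpha> * u x"
    unfolding angular_def D_components[of x "perp x"] g1 g2
    by (simp add: scaleR_conv_of_real algebra_simps add_divide_distrib)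
  then have ang: "angular \<alpha> x = of_real (x $ 1) * g $ 2 - of_real (x $ 2) * g $ 1"
    unfolding n'[symmetric] using n0 by (simp add: mult_ac)
  \<comment> \<open>The coordinates of \<open>x\<close> are real, so the mixed terms in
    \<open>g $ 1\<close> and \<open>g $ 2\<close> cancel.\<close>
  have "(norm (radial x))\<^sup>2 + (norm (angular \<alpha> x))\<^sup>2 = n * (norm g)\<^sup>2"
    unfolding rad ang norm_vec2_sq[of g] cmod_power2 n
    by (simp add: power2_eq_square algebra_simps)
  then have "(norm g)\<^sup>2 = (norm (radial x) / norm x)\<^sup>2 + (norm (angular \<alpha> x) / norm x)\<^sup>2"
    using n0 by (simp add: power_divide n_def[symmetric] field_simps)
  then show ?thesis
    unfolding g_def by (metis norm_ge_zero real_sqrt_unique)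
qed

lemma magnetic_gradient_powr_ge:
  assumes "2 \<le> p"
  shows "(norm (radial x) / norm x) powr p + (norm (angular \<alpha> x) / norm x) powr p
    \<le> norm (magnetic_gradient (AB_potential \<alpha>) u x) powr p"
proof -
  \<comment> \<open>Rewriting powers of norms as powers of their squares brings superadditivity into
    play with exponent \<open>p / 2\<close>.\<close>
  have half: "r powr p = r\<^sup>2 powr (p / 2)" if "0 \<le> r" for r :: real
    using that powr_powr[of r 2 "p / 2"] by (cases "r = 0") (auto simp: powr_numeral)
  show ?thesis
    using assms by (simp add: half norm_magnetic_gradient powr_add_superadditive)
qed

text \<open>A non-integrable function has Bochner integral 0, so bounding this integral from below
  by monotonicity rests on integrability. It holds since the integrand is continuous with bounded
  support.\<close>

lemma integrable_magnetic_gradient_powr: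
  assumes "0 < p"
  shows "integrable lborel (\<lambda>x. norm (magnetic_gradient (AB_potential \<alpha>) u x) powr p)"
  unfolding norm_magnetic_gradient using assms
  by (intro integrable_lborel_continuous_bounded_support[of _ b] continuous_on_powr'
      continuous_on_norm_divide continuous_intros continuous_on_radial continuous_on_angular)
    (auto simp: radial_zero angular_zero)

section \<open>Hardy inequality along dilations\<close>

text \<open>Integrate the derivative of \<open>u (exp (- s) *\<^sub>R x)\<close>. Time
  \<open>T\<close> suffices to carry every point of norm at most \<open>b\<close> into the hole of
  radius \<open>a\<close>, where \<open>u\<close> is 0; beyond \<open>b\<close> already
  \<open>u x\<close> is 0.\<close>

lemma norm_u_le_radial:
  assumes T: "b * exp (- T) < a" "0 < T"
  shows "norm (u x) \<le> integral {0..T} (\<lambda>s. norm (radial (exp (- s) *\<^sub>R x)))"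
proof -
  have cont: "continuous_on {0..T} (\<lambda>s. norm (radial (exp (- s) *\<^sub>R x)))"
    by (intro continuous_intros continuous_on_compose2[OF continuous_on_radial]) auto
  show ?thesis
  proof (cases "b < norm x")
    case True
    then have "u x = 0" by (simp add: u_zero)
    then show ?thesis
      by (simp add: integral_nonneg[OF integrable_continuous_interval[OF cont]])
  next
    case False
    have "((\<lambda>s. - radial (exp (- s) *\<^sub>R x)) has_integral
        u (exp (- T) *\<^sub>R x) - u (exp (- 0) *\<^sub>R x)) {0..T}"
    proof (intro fundamental_theorem_of_calculus)
      fix s :: real
      have "((\<lambda>s. exp (- s) *\<^sub>R x) has_vector_derivative - (exp (- s) *\<^sub>R x)) (at s within {0..T})"
        by (auto intro!: derivative_eq_intros simp: has_vector_derivative_def)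
      from vector_derivative_diff_chain_within[OF this has_derivative_at_withinI[OF has_derivative]]
      show "((\<lambda>s. u (exp (- s) *\<^sub>R x)) has_vector_derivative - radial (exp (- s) *\<^sub>R x)) (at s within {0..T})"
        by (simp add: o_def radial_def linear_neg[OF linear_D])
    qed (use T in simp)
    moreover have "u (exp (- T) *\<^sub>R x) = 0"
    proof (intro u_zero disjI1)
      have "norm (exp (- T) *\<^sub>R x) \<le> exp (- T) * b"
        using False by simp
      then show "norm (exp (- T) *\<^sub>R x) < a"
        using T(1) by (simp only: mult.commute[of b])
    qed
    ultimately have int: "((\<lambda>s. - radial (exp (- s) *\<^sub>R x)) has_integral - u x) {0..T}"
      by simp
    have "norm (integral {0..T} (\<lambda>s. - radial (exp (- s) *\<^sub>R x)))
        \<le> integral {0..T} (\<lambda>s. norm (radial (exp (- s) *\<^sub>R x)))"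
      using int
      by (intro integral_norm_bound_integral integrable_continuous_interval[OF cont])
        (auto simp: has_integral_integrable_integral)
    then show ?thesis
      using int by (simp add: has_integral_integrable_integral)
  qed
qed

text \<open>In the plane, composing with the dilation by \<open>exp (- s)\<close> multiplies p-norms
  by \<open>exp (2 * s / p)\<close>, while the weight \<open>1 / norm x\<close> contributes
  \<open>exp (- s)\<close>. The product is \<open>exp (- c * s)\<close> with
  \<open>c = (p - 2) / p\<close>, whose integral over all s > 0 is \<open>1 / c\<close>.\<close>

lemma Hardy_radial:
  assumes p: "2 < p"
  shows "((p - 2) / p) powr p * (\<integral>x. (norm (u x) / norm x) powr p \<partial>lborel)
    \<le> (\<integral>x. (norm (radial x) / norm x) powr p \<partial>lborel)"
proof -
  \<comment> \<open>This choice gives \<open>b * exp (- T) = a / 2\<close>.\<close>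
  define T where "T = ln (2 * b / a)"
  have T: "b * exp (- T) < a" "0 < T"
    using a ab by (auto simp: T_def exp_minus)
  define I where "I = (\<integral>x. (norm (u x) / norm x) powr p \<partial>lborel)"
  define G where "G = (\<integral>x. (norm (radial x) / norm x) powr p \<partial>lborel)"
  define W where "W = integral {0..T} (\<lambda>s. exp (- s) * exp (2 * s / p))"
  have cont: "continuous_on UNIV (\<lambda>x. norm (radial x) / norm x)"
    by (intro continuous_on_norm_divide continuous_on_radial radial_zero)
  have [measurable]: "(\<lambda>x. norm (radial x) / norm x) \<in> borel_measurable borel"
    by (intro borel_measurable_continuous_onI cont)
  have "(\<integral>\<^sup>+x. ennreal ((norm (u x) / norm x) powr p) \<partial>lborel)
      \<le> ennreal (W powr p) * (\<integral>\<^sup>+x. ennreal ((norm (radial x) / norm x) powr p) \<partial>lborel)"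
    unfolding W_def
  proof (rule Lp_bound_integral_translates[where L = "\<lambda>s x. exp (- s) *\<^sub>R x"])
    show "norm (u x) / norm x
        \<le> integral {0..T} (\<lambda>s. exp (- s) * (norm (radial (exp (- s) *\<^sub>R x)) / norm (exp (- s) *\<^sub>R x)))" for x
      using norm_u_le_radial[OF T, of x] by (simp add: integral_divide divide_right_mono)
  next
    fix s :: real
    have "(\<integral>\<^sup>+x. ennreal ((norm (radial (exp (- s) *\<^sub>R x)) / norm (exp (- s) *\<^sub>R x)) powr p) \<partial>lborel)
        = ennreal (exp (- s) powr - 2) * (\<integral>\<^sup>+x. ennreal ((norm (radial x) / norm x) powr p) \<partial>lborel)"
      using nn_integral_lborel_dilation[of "exp (- s)" "\<lambda>x. ennreal ((norm (radial x) / norm x) powr p)"]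
      by simp
    also have "exp (- s) powr - 2 = exp (2 * s / p) powr p"
      using p by (simp add: powr_def)
    finally show "(\<integral>\<^sup>+x. ennreal ((norm (radial (exp (- s) *\<^sub>R x)) / norm (exp (- s) *\<^sub>R x)) powr p) \<partial>lborel)
        = ennreal (exp (2 * s / p) powr p) * (\<integral>\<^sup>+x. ennreal ((norm (radial x) / norm x) powr p) \<partial>lborel)" .
  qed (use p T in \<open>auto intro!: continuous_intros cont\<close>)
  \<comment> \<open>All integrands are continuous with bounded support, so the estimate passes from
    nonnegative extended integrals to Bochner integrals.\<close>
  then have "ennreal I \<le> ennreal (W powr p) * ennreal G"
    unfolding I_def G_def using p
    by (simp add: nn_integral_eq_integral integrable_norm_divide_powr continuous_on_u u_zero
        continuous_on_radial radial_zero)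
  then have IG: "I \<le> W powr p * G"
    by (simp add: G_def flip: ennreal_mult')
  define c where "c = (p - 2) / p"
  have c: "0 < c"
    using p by (simp add: c_def)
  have "((\<lambda>s. exp (- s) * exp (2 * s / p)) has_integral - exp (- c * T) / c - (- exp (- c * 0) / c)) {0..T}"
  proof (intro fundamental_theorem_of_calculus)
    fix s :: real
    have "exp (- s) * exp (2 * s / p) = exp (- c * s)"
      using p by (simp add: c_def field_simps flip: exp_add)
    then show "((\<lambda>s. - exp (- c * s) / c) has_vector_derivative exp (- s) * exp (2 * s / p)) (at s within {0..T})"
      using c by (auto intro!: derivative_eq_intros simp: has_real_derivative_iff_has_vector_derivative[symmetric])
  qed (use T in simp)
  then have "W = (1 - exp (- c * T)) / c"
    using c by (simp add: W_def has_integral_integrable_integral field_simps)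
  \<comment> \<open>Stopping at \<open>T\<close> only decreases the integral, so the bound
    \<open>1 / c\<close> does not depend on \<open>a\<close> and \<open>b\<close>.\<close>
  then have W: "0 \<le> c * W" "c * W \<le> 1"
    using c T by (simp_all add: mult_nonneg_nonneg)
  have "c powr p * I \<le> c powr p * (W powr p * G)"
    using IG by (intro mult_left_mono) auto
  also have "\<dots> = (c * W) powr p * G"
    using c W(1) by (simp add: powr_mult zero_le_mult_iff)
  also have "\<dots> \<le> 1 * G"
    using W p powr_le1[of p "c * W"] by (intro mult_right_mono) (auto simp: G_def)
  finally show ?thesis
    by (simp add: c_def I_def G_def)
qed

section \<open>Hardy inequality along rotations\<close>

text \<open>With the integrating factor \<open>E\<close>, the derivative of
  \<open>E s * u (rot s x)\<close> is \<open>- (E s * angular \<alpha> (rot s x))\<close>. After a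
  full turn \<open>u\<close> returns to its value but \<open>E\<close> has changed from 1 to
  \<open>exp (2 * pi * \<i> * \<alpha>)\<close>, which leaves the stated multiple of
  \<open>u x\<close>.\<close>

lemma norm_u_le_angular:
  "norm (1 - exp (2 * pi * \<i> * \<alpha>)) * norm (u x)
    \<le> integral {0..2 * pi} (\<lambda>s. exp (- Im \<alpha> * s) * norm (angular \<alpha> (rot s x)))"
proof -
  define E where "E s = exp (\<i> * \<alpha> * complex_of_real s)" for s
  have norm_E: "norm (E s) = exp (- Im \<alpha> * s)" for s
    by (simp add: E_def norm_exp_eq_Re)
  have cont: "continuous_on {0..2 * pi} (\<lambda>s. exp (- Im \<alpha> * s) * norm (angular \<alpha> (rot s x)))"
    unfolding rot_def by (intro continuous_intros continuous_on_compose2[OF continuous_on_angular]) auto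
  have "((\<lambda>s. - (E s * angular \<alpha> (rot s x))) has_integral
      E (2 * pi) * u (rot (2 * pi) x) - E 0 * u (rot 0 x)) {0..2 * pi}"
  proof (intro fundamental_theorem_of_calculus)
    fix s :: real
    have "((\<lambda>s. u (rot s x)) has_vector_derivative - D (rot s x) (perp (rot s x))) (at s within {0..2 * pi})"
      using vector_derivative_diff_chain_within[OF has_vector_derivative_rot
          has_derivative_at_withinI[OF has_derivative]]
      by (simp add: o_def linear_neg[OF linear_D])
    moreover have "(E has_vector_derivative \<i> * \<alpha> * E s) (at s within {0..2 * pi})"
    proof -
      have "((\<lambda>z. exp (\<i> * \<alpha> * z)) has_field_derivative \<i> * \<alpha> * exp (\<i> * \<alpha> * of_real s)) (at (of_real s))"
        by (auto intro!: derivative_eq_intros)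
      then show ?thesis
        unfolding E_def[abs_def] by (rule has_vector_derivative_real_field)
    qed
    ultimately have "((\<lambda>s. E s * u (rot s x)) has_vector_derivative
        E s * (- D (rot s x) (perp (rot s x))) + \<i> * \<alpha> * E s * u (rot s x)) (at s within {0..2 * pi})"
      by (intro has_vector_derivative_mult)
    then show "((\<lambda>s. E s * u (rot s x)) has_vector_derivative - (E s * angular \<alpha> (rot s x)))
        (at s within {0..2 * pi})"
      by (simp add: angular_def algebra_simps)
  qed simp
  moreover have "E (2 * pi) * u (rot (2 * pi) x) - E 0 * u (rot 0 x) = - ((1 - exp (2 * pi * \<i> * \<alpha>)) * u x)"
    by (simp add: E_def rot_def algebra_simps)
  ultimately have int: "((\<lambda>s. - (E s * angular \<alpha> (rot s x))) has_integral
      - ((1 - exp (2 * pi * \<i> * \<alpha>)) * u x)) {0..2 * pi}"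
    by simp
  have "norm (integral {0..2 * pi} (\<lambda>s. - (E s * angular \<alpha> (rot s x))))
      \<le> integral {0..2 * pi} (\<lambda>s. exp (- Im \<alpha> * s) * norm (angular \<alpha> (rot s x)))"
    using int
    by (intro integral_norm_bound_integral integrable_continuous_interval[OF cont])
      (auto simp: has_integral_integrable_integral norm_mult norm_E)
  then show ?thesis
    using int by (simp add: has_integral_integrable_integral norm_mult)
qed

text \<open>Rotations preserve both Lebesgue measure and \<open>norm x\<close>, so the Minkowski
  bound has scaling factor 1 and its constant is just the integral of the weight in
  \<open>norm_u_le_angular\<close>.\<close>

lemma Hardy_angular:
  assumes p: "1 < p" and \<alpha>: "exp (2 * pi * \<i> * \<alpha>) \<noteq> 1"
  shows "(norm (1 - exp (2 * pi * \<i> * \<alpha>)) / integral {0..2 * pi} (\<lambda>s. exp (- Im \<alpha> * s))) powr p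
      * (\<integral>x. (norm (u x) / norm x) powr p \<partial>lborel)
    \<le> (\<integral>x. (norm (angular \<alpha> x) / norm x) powr p \<partial>lborel)"
proof -
  define n where "n = norm (1 - exp (2 * pi * \<i> * \<alpha>))"
  have n: "0 < n"
    using \<alpha> by (simp add: n_def)
  define K where "K = integral {0..2 * pi} (\<lambda>s. exp (- Im \<alpha> * s))"
  define I where "I = (\<integral>x. (norm (u x) / norm x) powr p \<partial>lborel)"
  define G where "G = (\<integral>x. (norm (angular \<alpha> x) / norm x) powr p \<partial>lborel)"
  have cont: "continuous_on UNIV (\<lambda>x. norm (angular \<alpha> x) / norm x)"
    by (intro continuous_on_norm_divide continuous_on_angular angular_zero)
  have [measurable]: "(\<lambda>x. norm (angular \<alpha> x) / norm x) \<in> borel_measurable borel"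
    by (intro borel_measurable_continuous_onI cont)
  have "(\<integral>\<^sup>+x. ennreal ((norm (u x) / norm x) powr p) \<partial>lborel)
      \<le> ennreal (integral {0..2 * pi} (\<lambda>s. exp (- Im \<alpha> * s) / n * 1) powr p)
        * (\<integral>\<^sup>+x. ennreal ((norm (angular \<alpha> x) / norm x) powr p) \<partial>lborel)"
  proof (rule Lp_bound_integral_translates[where L = rot])
    fix x
    have "norm (u x) \<le> integral {0..2 * pi} (\<lambda>s. exp (- Im \<alpha> * s) * norm (angular \<alpha> (rot s x))) / n"
      using norm_u_le_angular[of \<alpha> x] n by (simp add: n_def pos_le_divide_eq mult.commute)
    then have "norm (u x) / norm x
        \<le> integral {0..2 * pi} (\<lambda>s. exp (- Im \<alpha> * s) * norm (angular \<alpha> (rot s x))) / n / norm x"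
      by (rule divide_right_mono) simp
    then show "norm (u x) / norm x
        \<le> integral {0..2 * pi} (\<lambda>s. exp (- Im \<alpha> * s) / n * (norm (angular \<alpha> (rot s x)) / norm (rot s x)))"
      by (simp flip: integral_divide)
  next
    show "(\<integral>\<^sup>+x. ennreal ((norm (angular \<alpha> (rot s x)) / norm (rot s x)) powr p) \<partial>lborel)
        = ennreal (1 powr p) * (\<integral>\<^sup>+x. ennreal ((norm (angular \<alpha> x) / norm x) powr p) \<partial>lborel)" for s
      by (subst nn_integral_lborel_orthogonal[OF orthogonal_transformation_rot]) simp_all
  qed (use p n in \<open>auto intro!: continuous_intros cont continuous_on_rot\<close>)
  then have "ennreal I \<le> ennreal ((K / n) powr p) * ennreal G"
    unfolding I_def G_def K_def using p
    by (simp add: nn_integral_eq_integral integrable_norm_divide_powr continuous_on_u u_zero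
        continuous_on_angular angular_zero)
  then have IG: "I \<le> (K / n) powr p * G"
    by (simp add: G_def flip: ennreal_mult')
  have K: "0 \<le> K"
    unfolding K_def by (intro integral_nonneg integrable_continuous_interval continuous_intros) auto
  have "(n / K) powr p * I \<le> (n / K) powr p * ((K / n) powr p * G)"
    using IG by (intro mult_left_mono) auto
  also have "\<dots> = (n / K * (K / n)) powr p * G"
    using n K by (simp only: powr_mult mult.assoc)
  \<comment> \<open>The product of the two quotients is 1, or 0 by the convention for division if
    \<open>K = 0\<close>; the bound covers both cases.\<close>
  also have "\<dots> \<le> 1 * G"
    using n p powr_le1[of p "n / K * (K / n)"] by (intro mult_right_mono) (auto simp: G_def)
  finally show ?thesis
    by (simp add: n_def K_def I_def G_def)
qed

end

section \<open>Evaluation of the angular constant\<close>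

text \<open>For \<alpha> = \<mu> + i \<nu> the left side is 2 |exp(i \<pi> \<alpha>)| |sin(\<pi>
  \<alpha>)|; the first modulus is \<open>exp (- (pi * \<nu>))\<close> and the second is the square
  root.\<close>

lemma norm_one_minus_exp:
  fixes \<mu> \<nu> :: real
  shows "norm (1 - exp (2 * pi * \<i> * (complex_of_real \<mu> + \<i> * complex_of_real \<nu>)))
    = 2 * exp (- (pi * \<nu>)) * sqrt ((sin (pi * \<mu>))\<^sup>2 + (sinh (pi * \<nu>))\<^sup>2)"
proof -
  define e where "e = exp (- (pi * \<nu>))"
  define z where "z = exp (2 * pi * \<i> * (complex_of_real \<mu> + \<i> * complex_of_real \<nu>))"
  have e: "0 < e" "exp (pi * \<nu>) = 1 / e"
    by (simp_all add: e_def exp_minus field_simps)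
  have e2: "exp (- (2 * (pi * \<nu>))) = e\<^sup>2"
    by (simp add: e_def flip: exp_double)
  have z: "Re z = e\<^sup>2 * cos (2 * (pi * \<mu>))" "Im z = e\<^sup>2 * sin (2 * (pi * \<mu>))"
    unfolding z_def Re_exp Im_exp by (simp_all add: e2 mult.assoc)
  have sh: "sinh (pi * \<nu>) = (1 / e - e) / 2"
    by (simp add: sinh_def e(2) e_def[symmetric])
  have "(norm (1 - z))\<^sup>2 = (1 - Re z)\<^sup>2 + (Im z)\<^sup>2"
    by (simp add: cmod_power2)
  also have "\<dots> = 1 - 2 * e\<^sup>2 * cos (2 * (pi * \<mu>)) + e ^ 4 * ((cos (2 * (pi * \<mu>)))\<^sup>2 + (sin (2 * (pi * \<mu>)))\<^sup>2)"
    unfolding z by algebra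
  also have "\<dots> = 1 - 2 * e\<^sup>2 * (1 - 2 * (sin (pi * \<mu>))\<^sup>2) + e ^ 4"
    by (subst sin_cos_squared_add2) (simp only: cos_double_sin mult_1_right)
  also have "\<dots> = (2 * e)\<^sup>2 * ((sin (pi * \<mu>))\<^sup>2 + (sinh (pi * \<nu>))\<^sup>2)"
    using e(1) unfolding sh by (simp add: field_simps power2_eq_square power4_eq_xxxx)
  finally have "(norm (1 - z))\<^sup>2 = (2 * e * sqrt ((sin (pi * \<mu>))\<^sup>2 + (sinh (pi * \<nu>))\<^sup>2))\<^sup>2"
    by (simp add: power_mult_distrib)
  then show ?thesis
    using e(1) by (simp add: z_def e_def power2_eq_iff_nonneg)
qed

text \<open>The factor \<open>2 * exp (- (pi * \<nu>))\<close> is split off so that it cancels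
  against the one in \<open>norm_one_minus_exp\<close>. Absolute values may be inserted because
  \<open>sinh\<close> is odd, and for \<nu> = 0 the value \<open>1 / pi\<close> gives the length
  \<open>2 * pi\<close>.\<close>

lemma integral_exp_period:
  fixes \<nu> :: real
  shows "integral {0..2 * pi} (\<lambda>s. exp (- \<nu> * s)) = 2 * exp (- (pi * \<nu>)) / abs_div_sinh_pi \<nu>"
proof (cases "\<nu> = 0")
  case True
  then show ?thesis by (simp add: abs_div_sinh_pi_def)
next
  case False
  have "((\<lambda>s. exp (- \<nu> * s)) has_integral - exp (- \<nu> * (2 * pi)) / \<nu> - (- exp (- \<nu> * 0) / \<nu>)) {0..2 * pi}"
    using False
    by (intro fundamental_theorem_of_calculus)
      (auto intro!: derivative_eq_intros simp: has_real_derivative_iff_has_vector_derivative[symmetric])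
  then have "integral {0..2 * pi} (\<lambda>s. exp (- \<nu> * s)) = (1 - exp (- \<nu> * (2 * pi))) / \<nu>"
    by (simp add: has_integral_integrable_integral diff_divide_distrib)
  also have "1 - exp (- \<nu> * (2 * pi)) = 2 * exp (- (pi * \<nu>)) * sinh (pi * \<nu>)"
    by (simp add: sinh_def algebra_simps flip: exp_add)
  also have "sinh (pi * \<nu>) / \<nu> = sinh (pi * \<bar>\<nu>\<bar>) / \<bar>\<nu>\<bar>"
    by (cases "0 \<le> \<nu>") auto
  then have "2 * exp (- (pi * \<nu>)) * sinh (pi * \<nu>) / \<nu> = 2 * exp (- (pi * \<nu>)) / abs_div_sinh_pi \<nu>"
    using False by (simp add: abs_div_sinh_pi_def flip: times_divide_eq_right)
  finally show ?thesis .
qed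

section \<open>From test functions to the inequality\<close>

text \<open>Smoothness is given only off the origin, but the closed support misses 0 and hence a
  ball around it. On that ball \<open>u\<close> is 0, and gluing the two open sets gives class C^1
  on the plane.\<close>

lemma C1_annulus_support_test_function:
  fixes u :: "real^2 \<Rightarrow> complex"
  assumes "u \<in> test_functions (UNIV - {0})"
  obtains a b where "C1_annulus_support u a b"
proof -
  let ?K = "closure {x. u x \<noteq> 0}"
  have smooth: "k_times_cont_diff_on 1 (UNIV - {0}) u" and K: "compact ?K" "0 \<notin> ?K"
    using assms by (auto simp: test_functions_def smooth_on_def)
  have diff0: "u differentiable (at x)" if "x \<noteq> 0" for x
    using smooth that by simp
  have cont0: "continuous_on (UNIV - {0}) (\<lambda>x. frechet_derivative u (at x) v)" for v
    using smooth by simp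
  have "open (- ?K)" "0 \<in> - ?K"
    using K by auto
  then obtain a where a: "0 < a" "ball 0 a \<subseteq> - ?K"
    by (meson openE)
  obtain b0 where b0: "\<And>x. x \<in> ?K \<Longrightarrow> norm x \<le> b0"
    using compact_imp_bounded[OF K(1)] by (auto simp: bounded_iff)
  \<comment> \<open>The maximum with \<open>a + 1\<close> ensures \<open>a < b\<close>, also when
    \<open>u\<close> is identically 0.\<close>
  define b where "b = max b0 (a + 1)"
  have u_near: "u x = 0" if "x \<in> ball 0 a" for x
    using that a closure_subset[of "{x. u x \<noteq> 0}"] by blast
  have u_far: "u x = 0" if "b < norm x" for x
  proof (rule ccontr)
    assume "u x \<noteq> 0"
    then have "x \<in> ?K"
      using closure_subset[of "{x. u x \<noteq> 0}"] by blast
    then show False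
      using b0[of x] that by (simp add: b_def)
  qed
  have near: "(u has_derivative (\<lambda>_. 0)) (at x)" if "x \<in> ball 0 a" for x
    by (rule has_derivative_transform_within_open[OF has_derivative_const open_ball that])
      (simp add: u_near)
  have cont_near: "continuous_on (ball 0 a) (\<lambda>x. frechet_derivative u (at x) v)" for v
  proof (rule continuous_on_eq[of _ "\<lambda>_. 0"])
    show "0 = frechet_derivative u (at x) v" if "x \<in> ball 0 a" for x
      using frechet_derivative_at[OF near[OF that]] by metis
  qed simp
  have "C1_annulus_support u a b"
  proof
    show "u differentiable (at x)" for x
      using diff0[of x] near[of x] a(1) by (cases "x = 0") (auto simp: differentiable_def)
    show "continuous_on UNIV (\<lambda>x. frechet_derivative u (at x) v)" for v
    proof -
      have "continuous_on ((UNIV - {0}) \<union> ball 0 a) (\<lambda>x. frechet_derivative u (at x) v)"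
        by (intro continuous_on_open_Un cont0 cont_near) (auto simp: open_delete)
      moreover have "(UNIV - {0}) \<union> ball (0::real^2) a = UNIV"
        using a(1) by auto
      ultimately show ?thesis by simp
    qed
  qed (use a u_near u_far in \<open>auto simp: b_def\<close>)
  then show ?thesis by (rule that)
qed

theorem corollary4p3:
  fixes p \<mu> \<nu> :: real and \<alpha> :: complex and u :: "real^2 \<Rightarrow> complex"
  assumes "2 \<le> p"
    and "\<alpha> = complex_of_real \<mu> + \<i> * complex_of_real \<nu>"
    and "\<alpha> \<notin> \<int>"
    and "u \<in> test_functions (UNIV - {0})"
  shows "(\<integral>x. norm (magnetic_gradient (AB_potential \<alpha>) u x) powr p \<partial>lborel)
    \<ge> (((p - 2) / p) powr p
        + abs_div_sinh_pi \<nu> powr p * ((sin (pi * \<mu>))\<^sup>2 + (sinh (pi * \<nu>))\<^sup>2) powr (p / 2))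
      * (\<integral>x. norm (u x) powr p / norm x powr p \<partial>lborel)"
proof -
  obtain a b where "C1_annulus_support u a b"
    using assms(4) by (rule C1_annulus_support_test_function)
  then interpret C1_annulus_support u a b .
  define S where "S = (sin (pi * \<mu>))\<^sup>2 + (sinh (pi * \<nu>))\<^sup>2"
  define I where "I = (\<integral>x. (norm (u x) / norm x) powr p \<partial>lborel)"
  define R where "R = (\<integral>x. (norm (radial x) / norm x) powr p \<partial>lborel)"
  define A where "A = (\<integral>x. (norm (angular \<alpha> x) / norm x) powr p \<partial>lborel)"
  have S0: "0 \<le> S"
    \<comment> \<open>\<open>S\<close> is the square of |sin(\<pi> \<alpha>)|, so it vanishes
      exactly at the integers; this is how \<open>\<alpha> \<notin> \<int>\<close> enters.\<close>
    by (simp add: S_def)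
  have "S \<noteq> 0"
  proof
    assume "S = 0"
    then have "sin (pi * \<mu>) = 0" "\<nu> = 0"
      by (auto simp: S_def sum_power2_eq_zero_iff)
    then obtain i where "\<mu> = real_of_int i"
      by (auto simp: sin_zero_iff_int2)
    then show False
      using assms(2,3) \<open>\<nu> = 0\<close> by simp
  qed
  then have \<alpha>: "exp (2 * pi * \<i> * \<alpha>) \<noteq> 1"
    using norm_one_minus_exp[of \<mu> \<nu>] by (auto simp: assms(2) S_def)
  have Im: "Im \<alpha> = \<nu>"
    by (simp add: assms(2))
  have cp: "0 \<le> abs_div_sinh_pi \<nu>"
    by (simp add: abs_div_sinh_pi_def)
  have "norm (1 - exp (2 * pi * \<i> * \<alpha>)) / integral {0..2 * pi} (\<lambda>s. exp (- Im \<alpha> * s))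
      = abs_div_sinh_pi \<nu> * sqrt S"
    unfolding Im integral_exp_period unfolding assms(2) norm_one_minus_exp by (simp add: S_def)
  then have "(abs_div_sinh_pi \<nu> * sqrt S) powr p * I \<le> A"
    using Hardy_angular[of p \<alpha>] assms(1) \<alpha> by (simp add: I_def A_def)
  moreover have "(abs_div_sinh_pi \<nu> * sqrt S) powr p = abs_div_sinh_pi \<nu> powr p * S powr (p / 2)"
    using cp S0 by (simp add: powr_mult powr_half_sqrt[symmetric] powr_powr)
  ultimately have ang: "abs_div_sinh_pi \<nu> powr p * S powr (p / 2) * I \<le> A"
    by simp
  \<comment> \<open>For \<open>p = 2\<close> the constant is \<open>0 powr 2 = 0\<close> and the
    claim is just \<open>0 \<le> R\<close>.\<close>
  have rad: "((p - 2) / p) powr p * I \<le> R"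
    using Hardy_radial[of p] assms(1) by (cases "p = 2") (auto simp: I_def R_def)
  have "(((p - 2) / p) powr p + abs_div_sinh_pi \<nu> powr p * S powr (p / 2)) * I \<le> R + A"
    using ang rad by (simp add: distrib_right)
  also have "R + A = (\<integral>x. (norm (radial x) / norm x) powr p + (norm (angular \<alpha> x) / norm x) powr p \<partial>lborel)"
    unfolding R_def A_def using assms(1)
    by (intro Bochner_Integration.integral_add[symmetric] integrable_norm_divide_powr
        continuous_on_radial radial_zero continuous_on_angular angular_zero) auto
  also have "\<dots> \<le> (\<integral>x. norm (magnetic_gradient (AB_potential \<alpha>) u x) powr p \<partial>lborel)"
    using assms(1)
    by (intro integral_mono Bochner_Integration.integrable_add integrable_norm_divide_powr
        continuous_on_radial radial_zero continuous_on_angular angular_zero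
        integrable_magnetic_gradient_powr magnetic_gradient_powr_ge) auto
  finally show ?thesis
    by (simp add: S_def I_def powr_divide)
qed

end
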